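(* Let $G$ be a $(d,s)$-edge colorable graph and let $L'$ be a list assignment for the edges of $G$, with $L'(e)\subseteq\{1,\dots,d\}$, such that $|L'(e)|\le s-1$ for each edge $e$ of $G$. If the edges $e$ with $L'(e)\neq\emptyset$ all belong to one distance-$3$ matching in $G$, then $L'$ is avoidable, i.e. there is a proper $d$-edge coloring $\varphi$ of $G$ with colors $\{1,\dots,d\}$ such that $\varphi(e)\notin L'(e)$ for every edge $e$ of $G$.
   Context: Graphs are finite and simple. A cycle in an edge-colored graph is $2$-colored if its edges are properly colored by two distinct colors (so a $4$-cycle is $2$-colored if its edges alternate between two distinct colors). For integers $d,s$, a $d$-regular graph $G$ is $(d,s)$-edge colorable if it admits a proper $d$-edge coloring (with colors $\{1,\dots,d\}$) in which every edge of $G$ is contained in at least $s-1$ $2$-colored $4$-cycles. The distance between two edges $e,e'$ is the number of edges in a shortest path between an endpoint of $e$ and an endpoint of $e'$. A distance-$t$ matching is a matching in which any two (distinct) edges are at distance at least $t$ from each other. *)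

theory Defs
  imports Main "HOL-Library.Extended_Nat"
begin

text \<open>A graph is given by its vertex set and its set of edges, an edge being a two-element set of
  vertices. Colorings and list assignments are functions on all sets of vertices; only their
  values on the edges matter.\<close>

definition simple_graph :: "'a set \<Rightarrow> 'a set set \<Rightarrow> bool" where
  "simple_graph V E \<longleftrightarrow> finite V \<and> (\<forall>e\<in>E. e \<subseteq> V \<and> card e = 2)"

definition regular_graph :: "'a set \<Rightarrow> 'a set set \<Rightarrow> nat \<Rightarrow> bool" where
  "regular_graph V E d \<longleftrightarrow> simple_graph V E \<and> (\<forall>v\<in>V. card {e\<in>E. v \<in> e} = d)"

definition proper_on :: "'a set set \<Rightarrow> ('a set \<Rightarrow> nat) \<Rightarrow> bool" where
  "proper_on F \<phi> \<longleftrightarrow> (\<forall>e\<in>F. \<forall>f\<in>F. e \<noteq> f \<longrightarrow> e \<inter> f \<noteq> {} \<longrightarrow> \<phi> e \<noteq> \<phi> f)"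

definition proper_edge_coloring :: "'a set set \<Rightarrow> nat \<Rightarrow> ('a set \<Rightarrow> nat) \<Rightarrow> bool" where
  "proper_edge_coloring E d \<phi> \<longleftrightarrow> (\<forall>e\<in>E. \<phi> e \<in> {1..d}) \<and> proper_on E \<phi>"

text \<open>A cycle is identified with its set of edges, so that different cyclic orderings of the
  vertices along the same cycle are not counted separately.\<close>

definition cycle_of_length :: "'a set set \<Rightarrow> nat \<Rightarrow> 'a set set \<Rightarrow> bool" where
  "cycle_of_length E n C \<longleftrightarrow> n \<ge> 3 \<and> C \<subseteq> E \<and>
     (\<exists>vs. length vs = n \<and> distinct vs \<and> C = {{vs ! i, vs ! (Suc i mod n)} | i. i < n})"

definition two_colored :: "('a set \<Rightarrow> nat) \<Rightarrow> 'a set set \<Rightarrow> bool" where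
  "two_colored \<phi> C \<longleftrightarrow> proper_on C \<phi> \<and> card (\<phi> ` C) = 2"

text \<open>The parameter \<open>s\<close> is an integer so that \<open>s - 1\<close> is not truncated.\<close>

definition edge_colorable :: "'a set \<Rightarrow> 'a set set \<Rightarrow> nat \<Rightarrow> int \<Rightarrow> bool" where
  "edge_colorable V E d s \<longleftrightarrow> regular_graph V E d \<and>
     (\<exists>\<phi>. proper_edge_coloring E d \<phi> \<and>
        (\<forall>e\<in>E. int (card {C. cycle_of_length E 4 C \<and> two_colored \<phi> C \<and> e \<in> C}) \<ge> s - 1))"

definition is_path :: "'a set \<Rightarrow> 'a set set \<Rightarrow> 'a list \<Rightarrow> bool" where
  "is_path V E p \<longleftrightarrow> p \<noteq> [] \<and> distinct p \<and> set p \<subseteq> V \<and>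
     (\<forall>i. Suc i < length p \<longrightarrow> {p ! i, p ! Suc i} \<in> E)"

text \<open>A path with vertex list \<open>p\<close> has \<open>length p - 1\<close> edges. The infimum over the empty set is
  \<open>\<infinity>\<close>, the distance between edges in different components.\<close>

definition edge_dist :: "'a set \<Rightarrow> 'a set set \<Rightarrow> 'a set \<Rightarrow> 'a set \<Rightarrow> enat" where
  "edge_dist V E e e' = (INF p \<in> {p. is_path V E p \<and> hd p \<in> e \<and> last p \<in> e'}. enat (length p - 1))"

definition matching :: "'a set set \<Rightarrow> 'a set set \<Rightarrow> bool" where
  "matching E M \<longleftrightarrow> M \<subseteq> E \<and> (\<forall>e\<in>M. \<forall>f\<in>M. e \<noteq> f \<longrightarrow> e \<inter> f = {})"

definition distance_matching :: "'a set \<Rightarrow> 'a set set \<Rightarrow> nat \<Rightarrow> 'a set set \<Rightarrow> bool" where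
  "distance_matching V E t M \<longleftrightarrow> matching E M \<and>
     (\<forall>e\<in>M. \<forall>f\<in>M. e \<noteq> f \<longrightarrow> edge_dist V E e f \<ge> enat t)"

definition avoidable :: "'a set set \<Rightarrow> nat \<Rightarrow> ('a set \<Rightarrow> nat set) \<Rightarrow> bool" where
  "avoidable E d L \<longleftrightarrow> (\<exists>\<phi>. proper_edge_coloring E d \<phi> \<and> (\<forall>e\<in>E. \<phi> e \<notin> L e))"

end

theory Submission
  imports Defs
begin

text \<open>Start from a coloring witnessing \<open>(d,s)\<close>-edge colorability. An edge \<open>e\<close> whose color is
  forbidden lies in at least \<open>s - 1\<close> two-colored 4-cycles, which have pairwise different second
  colors, while at most \<open>s - 2\<close> colors other than that of \<open>e\<close> are forbidden for \<open>e\<close>. So some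
  cycle through \<open>e\<close> has an allowed second color, and interchanging its two colors repairs \<open>e\<close>.
  The cycles so chosen for different edges are vertex-disjoint, and a cycle chosen for \<open>e\<close> meets no
  other edge of the matching, because every vertex of such a cycle is at distance at most 1 from
  \<open>e\<close>. Hence all interchanges can be made at once without creating new conflicts.\<close>

section \<open>Two-colored 4-cycles\<close>

lemma cycle_of_length_4D:
  assumes "cycle_of_length E 4 C"
  obtains w x y z where "distinct [w, x, y, z]" "C = {{w, x}, {x, y}, {y, z}, {z, w}}" "C \<subseteq> E"
proof -
  from assms obtain vs where vs: "length vs = 4" "distinct vs"
    "C = {{vs ! i, vs ! (Suc i mod 4)} | i. i < 4}"
    and "C \<subseteq> E"
    unfolding cycle_of_length_def by blast
  obtain w x y z where wxyz: "vs = [w, x, y, z]"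
    using vs(1) by (auto simp: length_Suc_conv eval_nat_numeral)
  have "{i :: nat. i < 4} = {0, 1, 2, 3}"
    by auto
  then have "C = (\<lambda>i. {vs ! i, vs ! (Suc i mod 4)}) ` {0, 1, 2, 3}"
    unfolding vs(3) by (simp add: setcompr_eq_image)
  also have "\<dots> = {{w, x}, {x, y}, {y, z}, {z, w}}"
    by (simp add: wxyz)
  finally show thesis
    using that vs(2) \<open>C \<subseteq> E\<close> wxyz by blast
qed

text \<open>A normal form in which the caller fixes the orientation of the edge, so that two cycles
  through it can be compared position by position. Consecutive edges differ in color and only two
  colors occur, hence the colors alternate.\<close>

lemma two_colored_4_cycleE:
  assumes "cycle_of_length E 4 C" "two_colored \<phi> C" "{a, b} \<in> C"
  obtains x y where "distinct [a, b, x, y]" "C = {{a, b}, {b, x}, {x, y}, {y, a}}"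
    "\<phi> {x, y} = \<phi> {a, b}" "\<phi> {y, a} = \<phi> {b, x}" "\<phi> {b, x} \<noteq> \<phi> {a, b}"
proof -
  obtain p q r t where pqrt: "distinct [p, q, r, t]" "C = {{p, q}, {q, r}, {r, t}, {t, p}}"
    using assms(1) by (rule cycle_of_length_4D)
  \<comment> \<open>\<open>P\<close> holds for the cyclic listings of the vertices of
    \<open>C\<close>. One rotation and one reflection generate all eight of them, matching the four
    edges with two orientations each in the case split below.\<close>
  define P where "P p q r t \<longleftrightarrow> distinct [p, q, r, t] \<and> C = {{p, q}, {q, r}, {r, t}, {t, p}}"
    for p q r t
  have rotate: "P q r t p" and reflect: "P q p t r" if "P p q r t" for p q r t
  proof -
    have "{{q, r}, {r, t}, {t, p}, {p, q}} = {{p, q}, {q, r}, {r, t}, {t, p}}"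
      by blast
    moreover have "{{q, p}, {p, t}, {t, r}, {r, q}} = {{p, q}, {q, r}, {r, t}, {t, p}}"
      unfolding insert_commute[of q p] insert_commute[of p t] insert_commute[of t r]
        insert_commute[of r q] by blast
    ultimately show "P q r t p" "P q p t r"
      using that unfolding P_def by auto
  qed
  have "P p q r t"
    using pqrt by (simp add: P_def)
  have "{a, b} = {p, q} \<or> {a, b} = {q, r} \<or> {a, b} = {r, t} \<or> {a, b} = {t, p}"
    using assms(3) by (simp only: pqrt(2) insert_iff empty_iff HOL.simp_thms)
  then consider "a = p" "b = q" | "a = q" "b = p" | "a = q" "b = r" | "a = r" "b = q"
    | "a = r" "b = t" | "a = t" "b = r" | "a = t" "b = p" | "a = p" "b = t"
    unfolding doubleton_eq_iff by argo
  then obtain x y where "P a b x y"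
    using \<open>P p q r t\<close> rotate reflect by cases blast+
  then have xy: "distinct [a, b, x, y]" "C = {{a, b}, {b, x}, {x, y}, {y, a}}"
    unfolding P_def by blast+
  have ne: "\<phi> {a, b} \<noteq> \<phi> {b, x}" "\<phi> {b, x} \<noteq> \<phi> {x, y}" "\<phi> {x, y} \<noteq> \<phi> {y, a}"
    "\<phi> {y, a} \<noteq> \<phi> {a, b}"
  proof -
    have *: "\<phi> g \<noteq> \<phi> h" if "g \<in> C" "h \<in> C" "g \<noteq> h" "g \<inter> h \<noteq> {}" for g h
      using assms(2) that unfolding two_colored_def proper_on_def by blast
    show "\<phi> {a, b} \<noteq> \<phi> {b, x}" "\<phi> {b, x} \<noteq> \<phi> {x, y}" "\<phi> {x, y} \<noteq> \<phi> {y, a}"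
      "\<phi> {y, a} \<noteq> \<phi> {a, b}"
      by (rule *; use xy(1) in \<open>simp add: xy(2) doubleton_eq_iff\<close>; blast?)+
  qed
  obtain k l where kl: "\<phi> ` C = {k, l}"
    using assms(2) unfolding two_colored_def card_2_iff by blast
  have "\<phi> {a, b} \<in> {k, l}" "\<phi> {b, x} \<in> {k, l}" "\<phi> {x, y} \<in> {k, l}" "\<phi> {y, a} \<in> {k, l}"
    using kl[symmetric] xy(2) by simp_all
  with ne have "\<phi> {x, y} = \<phi> {a, b}" "\<phi> {y, a} = \<phi> {b, x}"
    by auto
  with that xy ne show thesis
    by metis
qed

text \<open>Both color sets contain the color of \<open>e\<close>, so the second colors agree.
  Properness allows only one edge of that color at each end of \<open>e\<close>, and these two edges
  determine the other two vertices.\<close>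

lemma two_colored_4_cycle_unique:
  assumes "proper_on E \<phi>" and e: "e = {a, b}" "e \<in> C" "e \<in> C'"
    and "cycle_of_length E 4 C" "two_colored \<phi> C"
    and "cycle_of_length E 4 C'" "two_colored \<phi> C'"
    and eq: "\<phi> ` C = \<phi> ` C'"
  shows "C = C'"
proof -
  have "{a, b} \<in> C" "{a, b} \<in> C'"
    using e by simp_all
  obtain x y where xy: "distinct [a, b, x, y]" "C = {{a, b}, {b, x}, {x, y}, {y, a}}"
    "\<phi> {x, y} = \<phi> {a, b}" "\<phi> {y, a} = \<phi> {b, x}" "\<phi> {b, x} \<noteq> \<phi> {a, b}"
    by (rule two_colored_4_cycleE[OF assms(5,6) \<open>{a, b} \<in> C\<close>])
  obtain x' y' where xy': "distinct [a, b, x', y']" "C' = {{a, b}, {b, x'}, {x', y'}, {y', a}}"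
    "\<phi> {x', y'} = \<phi> {a, b}" "\<phi> {y', a} = \<phi> {b, x'}" "\<phi> {b, x'} \<noteq> \<phi> {a, b}"
    by (rule two_colored_4_cycleE[OF assms(7,8) \<open>{a, b} \<in> C'\<close>])
  have "C \<subseteq> E" "C' \<subseteq> E"
    using assms unfolding cycle_of_length_def by auto
  then have E: "{b, x} \<in> E" "{y, a} \<in> E" "{b, x'} \<in> E" "{y', a} \<in> E"
    using xy(2) xy'(2) by auto
  have "\<phi> {b, x} = \<phi> {b, x'}"
    using eq xy xy' by auto
  then have "{b, x} = {b, x'}" "{y, a} = {y', a}"
    using assms(1) E xy(4) xy'(4) unfolding proper_on_def by (metis IntI empty_iff insertCI)+
  then have "x = x'" "y = y'"
    by (auto simp: doubleton_eq_iff)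
  with xy(2) xy'(2) show ?thesis by simp
qed

text \<open>Each color class is a pair of opposite edges, which covers all four vertices.\<close>

lemma two_colored_4_cycle_spanning:
  assumes "cycle_of_length E 4 C" "two_colored \<phi> C" "v \<in> \<Union>C" "k \<in> \<phi> ` C"
  shows "\<exists>g\<in>C. v \<in> g \<and> \<phi> g = k"
proof -
  obtain p q r t where "C = {{p, q}, {q, r}, {r, t}, {t, p}}"
    using assms(1) by (rule cycle_of_length_4D)
  then have pq: "{p, q} \<in> C" by simp
  obtain x y where "C = {{p, q}, {q, x}, {x, y}, {y, p}}" "\<phi> {x, y} = \<phi> {p, q}"
    "\<phi> {y, p} = \<phi> {q, x}"
    using two_colored_4_cycleE[OF assms(1,2) pq] by metis
  with assms(3,4) show ?thesis by auto
qed

lemma cycle_4_vertex_near: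
  assumes "cycle_of_length E 4 C" "e \<in> C" "v \<in> \<Union>C"
  shows "\<exists>b\<in>e. v = b \<or> {v, b} \<in> E"
proof -
  obtain p q r t where "C = {{p, q}, {q, r}, {r, t}, {t, p}}" "C \<subseteq> E"
    using assms(1) by (rule cycle_of_length_4D)
  with assms(2,3) show ?thesis
    by (auto simp: insert_commute)
qed

section \<open>The choice of cycles and the simultaneous interchange\<close>

lemma allowed_cycle:
  assumes graph: "simple_graph V E" and proper: "proper_edge_coloring E d \<phi>" and "e \<in> E"
    and many: "int (card {C. cycle_of_length E 4 C \<and> two_colored \<phi> C \<and> e \<in> C}) \<ge> s - 1"
    and L: "finite L" "int (card L) \<le> s - 1" "\<phi> e \<in> L"
  shows "\<exists>C. cycle_of_length E 4 C \<and> two_colored \<phi> C \<and> e \<in> C \<and> (\<forall>k\<in>\<phi> ` C. k \<noteq> \<phi> e \<longrightarrow> k \<notin> L)"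
proof (rule ccontr)
  assume none: "\<not> ?thesis"
  define S where "S = {C. cycle_of_length E 4 C \<and> two_colored \<phi> C \<and> e \<in> C}"
  have "card e = 2"
    using graph \<open>e \<in> E\<close> unfolding simple_graph_def by simp
  then obtain a b where e: "e = {a, b}"
    unfolding card_2_iff by blast
  have inj: "inj_on (image \<phi>) S"
    using two_colored_4_cycle_unique[of E \<phi> e a b] proper e
    unfolding S_def inj_on_def proper_edge_coloring_def by blast
  \<comment> \<open>By \<open>inj\<close>, the cycles can be counted through their color sets. Each
    such set is fixed by its second color, which is forbidden by the assumption for
    contradiction.\<close>
  have "image \<phi> ` S \<subseteq> (\<lambda>k. {\<phi> e, k}) ` (L - {\<phi> e})"
  proof clarify
    fix C assume C: "C \<in> S"
    then obtain k where k: "k \<in> \<phi> ` C" "k \<noteq> \<phi> e" "k \<in> L"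
      using none unfolding S_def by blast
    have "\<phi> e \<in> \<phi> ` C" "card (\<phi> ` C) = 2"
      using C unfolding S_def two_colored_def by blast+
    moreover from this(2) obtain x y where "\<phi> ` C = {x, y}"
      unfolding card_2_iff by blast
    ultimately have "\<phi> ` C = {\<phi> e, k}"
      using k(1,2) by auto
    with k show "\<phi> ` C \<in> (\<lambda>k. {\<phi> e, k}) ` (L - {\<phi> e})" by blast
  qed
  then have "card (image \<phi> ` S) \<le> card (L - {\<phi> e})"
    using L(1) by (meson card_image_le card_mono finite_Diff finite_imageI le_trans)
  \<comment> \<open>The strictness comes from \<open>\<phi> e \<in> L\<close>: the current color
    uses up one forbidden color.\<close>
  also have "\<dots> < card L"
    using L(1,3) by (rule card_Diff1_less)
  finally have "card S < card L"
    unfolding card_image[OF inj] .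
  with many L(2) show False
    unfolding S_def by linarith
qed

lemma edge_dist_le_2:
  assumes "simple_graph V E" and "e \<in> E" "f \<in> E" "e \<inter> f = {}"
    and "a \<in> e" "v = a \<or> {v, a} \<in> E" and "b \<in> f" "v = b \<or> {v, b} \<in> E"
  shows "edge_dist V E e f \<le> 2"
proof -
  have V: "a \<in> V" "b \<in> V" "v \<in> V"
    using assms unfolding simple_graph_def by blast+
  have "a \<noteq> b" using assms by auto
  \<comment> \<open>The vertices of a path are distinct, so \<open>v\<close> is dropped when it
    coincides with an end; then \<open>a\<close> and \<open>b\<close> are adjacent.\<close>
  define p where "p = (if v = a \<or> v = b then [a, b] else [a, v, b])"
  have "is_path V E p"
    using assms V \<open>a \<noteq> b\<close> unfolding is_path_def p_def
    by (auto simp: insert_commute less_Suc_eq)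
  moreover have "hd p \<in> e" "last p \<in> f"
    using assms by (auto simp: p_def)
  ultimately have "edge_dist V E e f \<le> enat (length p - 1)"
    unfolding edge_dist_def by (intro INF_lower) simp
  also have "\<dots> \<le> enat 2"
    by (simp add: p_def)
  finally show ?thesis by (simp add: numeral_eq_enat)
qed

text \<open>At every vertex of a cycle the interchange only permutes the two colors already present
  there, so no edge outside can come into conflict. The members of \<open>F\<close> need not be
  4-cycles here: vertex-disjointness, two colors, and both colors at each vertex suffice.\<close>

lemma interchange_disjoint:
  assumes proper: "proper_edge_coloring E d \<phi>"
    and sub: "\<And>C. C \<in> F \<Longrightarrow> C \<subseteq> E"
    and two: "\<And>C. C \<in> F \<Longrightarrow> card (\<phi> ` C) = 2"
    and span: "\<And>C v k. C \<in> F \<Longrightarrow> v \<in> \<Union>C \<Longrightarrow> k \<in> \<phi> ` C \<Longrightarrow> \<exists>g\<in>C. v \<in> g \<and> \<phi> g = k"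
    and disj: "\<And>C D v. C \<in> F \<Longrightarrow> D \<in> F \<Longrightarrow> v \<in> \<Union>C \<Longrightarrow> v \<in> \<Union>D \<Longrightarrow> C = D"
    and nonempty: "\<And>g. g \<in> E \<Longrightarrow> g \<noteq> {}"
  obtains \<psi> where "proper_edge_coloring E d \<psi>"
    and "\<And>g. g \<notin> \<Union>F \<Longrightarrow> \<psi> g = \<phi> g"
    and "\<And>C g. C \<in> F \<Longrightarrow> g \<in> C \<Longrightarrow> \<psi> g \<in> \<phi> ` C - {\<phi> g}"
proof -
  \<comment> \<open>The choice is in fact forced: only one member of \<open>F\<close> contains
    \<open>g\<close>, by \<open>disj\<close> at a vertex of \<open>g\<close>, and it has only one
    other color.\<close>
  define \<psi> where "\<psi> g = (if g \<in> \<Union>F then SOME k. \<exists>C\<in>F. g \<in> C \<and> k \<in> \<phi> ` C - {\<phi> g} else \<phi> g)" for g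
  have out: "\<psi> g = \<phi> g" if "g \<notin> \<Union>F" for g
    using that by (simp add: \<psi>_def)
  have inside: "\<psi> g \<in> \<phi> ` C - {\<phi> g}" if "C \<in> F" "g \<in> C" for C g
  proof -
    obtain k l where "\<phi> ` C = {k, l}" "k \<noteq> l"
      using two[OF \<open>C \<in> F\<close>] unfolding card_2_iff by blast
    then have "(if \<phi> g = k then l else k) \<in> \<phi> ` C - {\<phi> g}"
      by simp
    then have "\<exists>k. \<exists>C\<in>F. g \<in> C \<and> k \<in> \<phi> ` C - {\<phi> g}"
      using that by blast
    from someI_ex[OF this] have "\<exists>D\<in>F. g \<in> D \<and> \<psi> g \<in> \<phi> ` D - {\<phi> g}"
      using that by (subst \<psi>_def, subst if_P) blast+
    then obtain D where "D \<in> F" "g \<in> D" "\<psi> g \<in> \<phi> ` D - {\<phi> g}"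
      by blast
    moreover obtain v where "v \<in> g"
      using \<open>C \<in> F\<close> \<open>g \<in> C\<close> nonempty sub by blast
    ultimately show ?thesis
      using disj[of C D v] that by blast
  qed
  have conflict: "\<phi> g \<noteq> \<phi> h" if "g \<in> E" "h \<in> E" "g \<noteq> h" "v \<in> g" "v \<in> h" for g h v
    using that proper unfolding proper_edge_coloring_def proper_on_def by blast
  have mixed: "\<psi> g \<noteq> \<psi> h" if "C \<in> F" "g \<in> C" "h \<in> E" "h \<notin> \<Union>F" "v \<in> g" "v \<in> h" for C g h v
  proof -
    \<comment> \<open>The new color of \<open>g\<close> was already at \<open>v\<close> before, on
      an edge \<open>g'\<close> of the same cycle, so \<open>h\<close> avoids it by properness of
      \<open>\<phi>\<close>.\<close>
    have "\<exists>g'\<in>C. v \<in> g' \<and> \<phi> g' = \<psi> g"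
      using span[of C v "\<psi> g"] inside[of C g] that by blast
    then obtain g' where g': "g' \<in> C" "v \<in> g'" "\<phi> g' = \<psi> g"
      by blast
    have "g' \<in> E" "g' \<noteq> h"
      using g'(1) \<open>C \<in> F\<close> \<open>h \<notin> \<Union>F\<close> sub by blast+
    then have "\<phi> g' \<noteq> \<phi> h"
      using conflict \<open>h \<in> E\<close> g'(2) \<open>v \<in> h\<close> by simp
    with g'(3) out[OF \<open>h \<notin> \<Union>F\<close>] show ?thesis by simp
  qed
  have "proper_on E \<psi>"
    unfolding proper_on_def
  proof (intro ballI impI)
    fix g h assume gh: "g \<in> E" "h \<in> E" "g \<noteq> h" "g \<inter> h \<noteq> {}"
    then obtain v where v: "v \<in> g" "v \<in> h" by blast
    have ne: "\<phi> g \<noteq> \<phi> h"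
      using conflict gh(1-3) v .
    show "\<psi> g \<noteq> \<psi> h"
    proof (cases "g \<in> \<Union>F \<and> h \<in> \<Union>F")
      case True
      then obtain C where C: "C \<in> F" "g \<in> C" "h \<in> C"
        using disj v by blast
      obtain k l where kl: "\<phi> ` C = {k, l}"
        using two[OF C(1)] unfolding card_2_iff by blast
      have "\<phi> g \<in> {k, l}" "\<phi> h \<in> {k, l}"
        unfolding kl[symmetric] using C(2,3) by blast+
      moreover have "\<psi> g \<in> {k, l} - {\<phi> g}" "\<psi> h \<in> {k, l} - {\<phi> h}"
        using inside[OF C(1,2)] inside[OF C(1,3)] unfolding kl .
      ultimately show ?thesis
        using ne unfolding Diff_iff insert_iff empty_iff by metis
    next
      case False
      then consider "g \<notin> \<Union>F" "h \<notin> \<Union>F" | C where "C \<in> F" "g \<in> C" "h \<notin> \<Union>F"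
        | C where "C \<in> F" "h \<in> C" "g \<notin> \<Union>F"
        by blast
      then show ?thesis
      proof cases
        case 1
        with out ne show ?thesis by simp
      next
        case 2
        with mixed gh v show ?thesis by blast
      next
        case 3
        with mixed[of C h g v] gh v show ?thesis by simp
      qed
    qed
  qed
  moreover have "\<psi> g \<in> {1..d}" if "g \<in> E" for g
  proof (cases "g \<in> \<Union>F")
    case True
    then obtain C where "C \<in> F" "g \<in> C" by blast
    then obtain h where "h \<in> C" "\<psi> g = \<phi> h"
      using inside by blast
    moreover from \<open>h \<in> C\<close> \<open>C \<in> F\<close> have "h \<in> E"
      using sub by blast
    ultimately show ?thesis
      using proper unfolding proper_edge_coloring_def by simp
  next
    case False
    with that out proper show ?thesis
      unfolding proper_edge_coloring_def by simp
  qed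
  ultimately show thesis
    using that out inside unfolding proper_edge_coloring_def by blast
qed

section \<open>Repairing all forbidden edges at once\<close>

theorem theorem1p6:
  fixes V :: "'a set" and E :: "'a set set" and d :: nat and s :: int
    and L' :: "'a set \<Rightarrow> nat set"
  assumes "edge_colorable V E d s"
    and "\<forall>e\<in>E. L' e \<subseteq> {1..d}"
    and "\<forall>e\<in>E. int (card (L' e)) \<le> s - 1"
    and "\<exists>M. distance_matching V E 3 M \<and> {e\<in>E. L' e \<noteq> {}} \<subseteq> M"
  shows "avoidable E d L'"
proof -
  obtain \<phi> where graph: "simple_graph V E" and proper: "proper_edge_coloring E d \<phi>"
    and many: "\<And>e. e \<in> E \<Longrightarrow>
      int (card {C. cycle_of_length E 4 C \<and> two_colored \<phi> C \<and> e \<in> C}) \<ge> s - 1"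
    using assms(1) unfolding edge_colorable_def regular_graph_def by blast
  have nonempty: "g \<noteq> {}" if "g \<in> E" for g
    using that graph unfolding simple_graph_def by fastforce
  obtain M where M: "distance_matching V E 3 M" "{e\<in>E. L' e \<noteq> {}} \<subseteq> M"
    using assms(4) by blast
  define B where "B = {e\<in>E. \<phi> e \<in> L' e}"
  have "\<exists>C. cycle_of_length E 4 C \<and> two_colored \<phi> C \<and> e \<in> C \<and> (\<forall>k\<in>\<phi> ` C. k \<noteq> \<phi> e \<longrightarrow> k \<notin> L' e)"
    if "e \<in> B" for e
  proof (rule allowed_cycle[OF graph proper])
    show "e \<in> E" "\<phi> e \<in> L' e" using that by (auto simp: B_def)
    then show "int (card {C. cycle_of_length E 4 C \<and> two_colored \<phi> C \<and> e \<in> C}) \<ge> s - 1"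
      "int (card (L' e)) \<le> s - 1" "finite (L' e)"
      using many assms(2,3) by (auto intro: finite_subset)
  qed
  then obtain Cyc where Cyc: "\<And>e. e \<in> B \<Longrightarrow> cycle_of_length E 4 (Cyc e)"
    "\<And>e. e \<in> B \<Longrightarrow> two_colored \<phi> (Cyc e)" "\<And>e. e \<in> B \<Longrightarrow> e \<in> Cyc e"
    "\<And>e k. e \<in> B \<Longrightarrow> k \<in> \<phi> ` Cyc e \<Longrightarrow> k \<noteq> \<phi> e \<Longrightarrow> k \<notin> L' e"
    by metis
  have BM: "B \<subseteq> M"
    using M(2) by (auto simp: B_def)
  \<comment> \<open>No vertex lies within one step of two edges of \<open>M\<close>. This is used
    twice: for a vertex common to two chosen cycles, and with \<open>v = a\<close> for a vertex of
    an edge on the cycle of another edge.\<close>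
  have far: "e = f" if "e \<in> M" "f \<in> M" "a \<in> e" "v = a \<or> {v, a} \<in> E" "b \<in> f" "v = b \<or> {v, b} \<in> E"
    for e f a b v
  proof (rule ccontr)
    assume "e \<noteq> f"
    then have "e \<in> E" "f \<in> E" "e \<inter> f = {}" "edge_dist V E e f \<ge> enat 3"
      using that M(1) unfolding distance_matching_def matching_def by blast+
    with edge_dist_le_2[OF graph _ _ _ that(3-6)] have "enat 3 \<le> 2"
      by (metis order_trans)
    then show False by (simp add: numeral_eq_enat)
  qed
  have disj: "e = f" if "e \<in> B" "f \<in> B" "v \<in> \<Union>(Cyc e)" "v \<in> \<Union>(Cyc f)" for e f v
  proof -
    obtain a where "a \<in> e" "v = a \<or> {v, a} \<in> E"
      using cycle_4_vertex_near[OF Cyc(1,3)] \<open>e \<in> B\<close> \<open>v \<in> \<Union>(Cyc e)\<close> by blast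
    moreover obtain b where "b \<in> f" "v = b \<or> {v, b} \<in> E"
      using cycle_4_vertex_near[OF Cyc(1,3)] \<open>f \<in> B\<close> \<open>v \<in> \<Union>(Cyc f)\<close> by blast
    ultimately show ?thesis
      using far \<open>e \<in> B\<close> \<open>f \<in> B\<close> BM by blast
  qed
  obtain \<psi> where \<psi>: "proper_edge_coloring E d \<psi>"
    "\<And>g. g \<notin> \<Union>(Cyc ` B) \<Longrightarrow> \<psi> g = \<phi> g"
    "\<And>C g. C \<in> Cyc ` B \<Longrightarrow> g \<in> C \<Longrightarrow> \<psi> g \<in> \<phi> ` C - {\<phi> g}"
  proof (rule interchange_disjoint[OF proper, where F = "Cyc ` B"])
    show "C \<subseteq> E" "card (\<phi> ` C) = 2" if "C \<in> Cyc ` B" for C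
      using that Cyc(1,2) unfolding cycle_of_length_def two_colored_def by auto
    show "\<exists>g\<in>C. v \<in> g \<and> \<phi> g = k" if "C \<in> Cyc ` B" "v \<in> \<Union>C" "k \<in> \<phi> ` C" for C v k
    proof -
      have "cycle_of_length E 4 C" "two_colored \<phi> C"
        using that(1) Cyc(1,2) by blast+
      then show ?thesis
        using that(2,3) by (rule two_colored_4_cycle_spanning)
    qed
    show "C = D" if "C \<in> Cyc ` B" "D \<in> Cyc ` B" "v \<in> \<Union>C" "v \<in> \<Union>D" for C D v
      using that disj by blast
    show "g \<noteq> {}" if "g \<in> E" for g
      using that by (rule nonempty)
  qed blast
  have "\<psi> e \<notin> L' e" if "e \<in> E" for e
  proof (cases "e \<in> \<Union>(Cyc ` B)")
    case False
    then have "e \<notin> B" using Cyc(3) by blast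
    with False that \<psi>(2) show ?thesis by (simp add: B_def)
  next
    case True
    then obtain f where f: "f \<in> B" "e \<in> Cyc f" by blast
    show ?thesis
    proof (cases "e = f")
      case True
      then show ?thesis using \<psi>(3)[of "Cyc f" e] Cyc(4)[OF f(1)] f by blast
    next
      case False
      obtain v where v: "v \<in> e"
        using nonempty[OF \<open>e \<in> E\<close>] by blast
      then obtain b where "b \<in> f" "v = b \<or> {v, b} \<in> E"
        using cycle_4_vertex_near[OF Cyc(1,3)[OF f(1)], of v] f(2) by blast
      \<comment> \<open>Outside \<open>M\<close> the list of \<open>e\<close> is empty, so its new
        color does no harm.\<close>
      then have "e \<notin> M"
        using far[of e f v v b] v f(1) BM False by blast
      then show ?thesis using M(2) that by blast
    qed
  qed
  with \<psi>(1) show ?thesis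
    unfolding avoidable_def by blast
qed

end
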